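(* Let $E$ and $F$ be Banach spaces over $\mathbb{K}$, let $n$ be a positive integer, let $1\le q\le p<\infty$, let $P\in\mathcal{P}(^{n}E;F)$ and let $a\in E$. Then $a\in S_{p;q}(P)$ if and only if $0\in S_{p;q}(\hat d^{k}P(a))$ for every $k=1,\ldots,n$.
   Context: $\mathbb{K}=\mathbb{R}$ or $\mathbb{C}$. $\mathcal{P}(^{n}E;F)$ is the space of continuous $n$-homogeneous polynomials from $E$ to $F$. For $P\in\mathcal{P}(^{n}E;F)$, $\check P$ denotes the symmetric $n$-linear mapping with $P(x)=\check P(x,\ldots,x)$. For $a\in E$ and $k\in\{1,\ldots,n\}$, $\hat d^{k}P(a)\in\mathcal{P}(^{k}E;F)$ is defined by $\hat d^{k}P(a)(x)=\frac{n!}{(n-k)!}\check P(a^{n-k},x^{k})$, where $(a^{n-k},x^{k})$ means $a$ repeated $n-k$ times followed by $x$ repeated $k$ times. $\ell_p(F)$ is the space of sequences $(y_j)_{j=1}^\infty$ in $F$ with $\sum_j\|y_j\|^p<\infty$. $\ell_q^{w}(E)$ is the space of sequences $(x_j)_{j=1}^\infty$ in $E$ with $(\varphi(x_j))_j\in\ell_q$ for all $\varphi\in E'$ (the dual of $E$), normed by $\|(x_j)_j\|_{w,q}=\sup\{(\sum_j|\varphi(x_j)|^q)^{1/q}:\varphi\in E',\|\varphi\|\le1\}$. $\ell_q^{u}(E)$ (unconditionally $q$-summable sequences) is the subspace of those $(x_j)_j\in\ell_q^w(E)$ with $\lim_{k\to\infty}\|(x_j)_{j=k}^\infty\|_{w,q}=0$.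 For $1\le q\le p<\infty$, a mapping $f\colon E\to F$ is $(p;q)$-summing at $a\in E$ if $(f(a+x_j)-f(a))_{j=1}^\infty\in\ell_p(F)$ whenever $(x_j)_{j=1}^\infty\in\ell_q^u(E)$. The $(p;q)$-summing set of $f$ is $S_{p;q}(f)=\{a\in E: f\text{ is }(p;q)\text{-summing at }a\}$. *)

theory Defs
  imports "HOL-Analysis.Analysis" "HOL-Combinatorics.Permutations"
begin

text \<open>
  The scalar field is a type of class \<open>real_normed_field\<close>. By the Gelfand-Mazur (Ostrowski)
  theorem such a field is isometrically isomorphic to the reals or to the complex numbers, so
  this class is exactly \<open>\<real>\<close> or \<open>\<complex>\<close>. The library has no normed spaces over a variable field;
  the scalar multiplication is therefore an explicit parameter, and the underlying real Banach
  space (group structure, norm, completeness) is provided by the class \<open>banach\<close>.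
\<close>

locale banach_space_over = vector_space scale
  for scale :: "'k::real_normed_field \<Rightarrow> 'e::banach \<Rightarrow> 'e" +
  assumes norm_scale: "norm (scale c x) = norm c * norm x"
    and scale_of_real: "scale (of_real r) x = r *\<^sub>R x"

text \<open>
  An \<open>n\<close>-tuple is given by the first \<open>n\<close> values of a sequence; the first conjunct says that the
  remaining values are irrelevant.
\<close>

definition multilinear ::
  "('k::field \<Rightarrow> 'e::ab_group_add \<Rightarrow> 'e) \<Rightarrow> ('k \<Rightarrow> 'f::ab_group_add \<Rightarrow> 'f) \<Rightarrow> nat
    \<Rightarrow> ((nat \<Rightarrow> 'e) \<Rightarrow> 'f) \<Rightarrow> bool"
  where "multilinear sE sF n A \<longleftrightarrow>
    (\<forall>x y. (\<forall>i<n. x i = y i) \<longrightarrow> A x = A y) \<and>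
    (\<forall>x. \<forall>i<n. Vector_Spaces.linear sE sF (\<lambda>t. A (x(i := t))))"

definition symmetric :: "nat \<Rightarrow> ((nat \<Rightarrow> 'e) \<Rightarrow> 'f) \<Rightarrow> bool"
  where "symmetric n A \<longleftrightarrow> (\<forall>\<pi> x. \<pi> permutes {..<n} \<longrightarrow> A (x \<circ> \<pi>) = A x)"

definition homogeneous_polynomials ::
  "('k::real_normed_field \<Rightarrow> 'e::real_normed_vector \<Rightarrow> 'e) \<Rightarrow> ('k \<Rightarrow> 'f::real_normed_vector \<Rightarrow> 'f)
    \<Rightarrow> nat \<Rightarrow> ('e \<Rightarrow> 'f) set"
  where "homogeneous_polynomials sE sF n =
    {P. continuous_on UNIV P \<and> (\<exists>A. multilinear sE sF n A \<and> (\<forall>x. P x = A (\<lambda>_. x)))}"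

text \<open>For an \<open>n\<close>-homogeneous polynomial the choice is unique by the polarization formula.\<close>

definition polar ::
  "('k::real_normed_field \<Rightarrow> 'e::real_normed_vector \<Rightarrow> 'e) \<Rightarrow> ('k \<Rightarrow> 'f::real_normed_vector \<Rightarrow> 'f)
    \<Rightarrow> nat \<Rightarrow> ('e \<Rightarrow> 'f) \<Rightarrow> (nat \<Rightarrow> 'e) \<Rightarrow> 'f"
  where "polar sE sF n P =
    (SOME A. multilinear sE sF n A \<and> symmetric n A \<and> (\<forall>x. P x = A (\<lambda>_. x)))"

definition hat_d ::
  "('k::real_normed_field \<Rightarrow> 'e::real_normed_vector \<Rightarrow> 'e) \<Rightarrow> ('k \<Rightarrow> 'f::real_normed_vector \<Rightarrow> 'f)
    \<Rightarrow> nat \<Rightarrow> nat \<Rightarrow> ('e \<Rightarrow> 'f) \<Rightarrow> 'e \<Rightarrow> 'e \<Rightarrow> 'f"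
  where "hat_d sE sF n k P a x =
    sF (fact n / fact (n - k)) (polar sE sF n P (\<lambda>i. if i < n - k then a else x))"

definition lp_seqs :: "real \<Rightarrow> (nat \<Rightarrow> 'f::real_normed_vector) set"
  where "lp_seqs p = {y. summable (\<lambda>j. norm (y j) powr p)}"

definition dual_space ::
  "('k::real_normed_field \<Rightarrow> 'e::real_normed_vector \<Rightarrow> 'e) \<Rightarrow> ('e \<Rightarrow> 'k) set"
  where "dual_space sE = {\<phi>. Vector_Spaces.linear sE (*) \<phi> \<and> continuous_on UNIV \<phi>}"

definition weak_lq_seqs ::
  "('k::real_normed_field \<Rightarrow> 'e::real_normed_vector \<Rightarrow> 'e) \<Rightarrow> real \<Rightarrow> (nat \<Rightarrow> 'e) set"
  where "weak_lq_seqs sE q = {x. \<forall>\<phi>\<in>dual_space sE. (\<lambda>j. \<phi> (x j)) \<in> lp_seqs q}"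

text \<open>
  The supremum is taken in \<open>ennreal\<close>, where it always exists; on \<open>weak_lq_seqs\<close> it is finite (by
  the uniform boundedness principle). Only its values on \<open>weak_lq_seqs\<close> are meaningful, since
  elsewhere the inner real series may diverge.
\<close>

definition weak_norm ::
  "('k::real_normed_field \<Rightarrow> 'e::real_normed_vector \<Rightarrow> 'e) \<Rightarrow> real \<Rightarrow> (nat \<Rightarrow> 'e) \<Rightarrow> ennreal"
  where "weak_norm sE q x =
    (SUP \<phi>\<in>{\<phi> \<in> dual_space sE. onorm \<phi> \<le> 1}.
      ennreal ((\<Sum>j. norm (\<phi> (x j)) powr q) powr (1 / q)))"

definition unconditional_lq_seqs ::
  "('k::real_normed_field \<Rightarrow> 'e::real_normed_vector \<Rightarrow> 'e) \<Rightarrow> real \<Rightarrow> (nat \<Rightarrow> 'e) set"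
  where "unconditional_lq_seqs sE q =
    {x \<in> weak_lq_seqs sE q. (\<lambda>k. weak_norm sE q (\<lambda>j. x (k + j))) \<longlonglongrightarrow> 0}"

definition summing_at ::
  "('k::real_normed_field \<Rightarrow> 'e::real_normed_vector \<Rightarrow> 'e) \<Rightarrow> real \<Rightarrow> real
    \<Rightarrow> ('e \<Rightarrow> 'f::real_normed_vector) \<Rightarrow> 'e \<Rightarrow> bool"
  where "summing_at sE p q f a \<longleftrightarrow>
    (\<forall>x\<in>unconditional_lq_seqs sE q. (\<lambda>j. f (a + x j) - f a) \<in> lp_seqs p)"

definition summing_set ::
  "('k::real_normed_field \<Rightarrow> 'e::real_normed_vector \<Rightarrow> 'e) \<Rightarrow> real \<Rightarrow> real
    \<Rightarrow> ('e \<Rightarrow> 'f::real_normed_vector) \<Rightarrow> 'e set"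
  where "summing_set sE p q f = {a. summing_at sE p q f a}"

end

theory Submission
  imports Defs
begin

text \<open>
  Taylor's formula for a homogeneous polynomial is a finite, purely algebraic identity:
  \<open>P (a + x) - P a\<close> is the sum over \<open>k = 1, ..., n\<close> of \<open>hat_d k P a x / k!\<close>
  (\<open>homogeneous_polynomial_taylor\<close>). Each summand is \<open>k\<close>-homogeneous in \<open>x\<close> and vanishes at
  \<open>x = 0\<close>. Summability of \<open>P\<close> at \<open>a\<close> therefore says that the sum of these components sends every
  unconditionally \<open>q\<close>-summable sequence into \<open>\<ell>\<^sub>p(F)\<close>, and summability of \<open>hat_d k P a\<close> at \<open>0\<close>
  says the same of a single component.

  If all components have this property, so does their sum, because \<open>\<ell>\<^sub>p(F)\<close> is a vector space.
  Conversely, unconditionally \<open>q\<close>-summable sequences may be multiplied by real scalars, and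
  dilation separates the degrees: if \<open>g\<close> is a sum of homogeneous components with distinct
  degrees, one of them \<open>m\<close>, then \<open>g (2 x) - 2 ^ m * g x\<close> has lost its component of degree \<open>m\<close>,
  while every other component \<open>Q k\<close> is only multiplied by \<open>2 ^ k - 2 ^ m \<noteq> 0\<close>. Induction on the
  set of degrees recovers each component (\<open>homogeneous_components_in_lp_seqs\<close>).

  Taylor's formula in turn requires a symmetric multilinear map that represents \<open>P\<close>; averaging any
  representing map over all permutations gives one (\<open>multilinear_symmetrize\<close>).
\<close>

section \<open>Multilinear maps\<close>

lemma multilinear_cong:
  assumes "multilinear sE sF n A" and "\<And>i. i < n \<Longrightarrow> x i = y i"
  shows "A x = A y"
  using assms unfolding multilinear_def by blast

lemma multilinear_slot_linear:
  assumes "multilinear sE sF n A" and "i < n"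
  shows "Vector_Spaces.linear sE sF (\<lambda>t. A (x(i := t)))"
  using assms unfolding multilinear_def by blast

lemma multilinear_slot_add:
  assumes "multilinear sE sF n A" and "i < n"
  shows "A (x(i := s + t)) = A (x(i := s)) + A (x(i := t))"
  using multilinear_slot_linear[OF assms, of x]
  by (simp add: Vector_Spaces.linear_iff)

lemma multilinear_slot_scale:
  assumes "multilinear sE sF n A" and "i < n"
  shows "A (x(i := sE c t)) = sF c (A (x(i := t)))"
  using multilinear_slot_linear[OF assms, of x]
  by (simp add: Vector_Spaces.linear_iff)

lemma multilinear_zero_slot:
  assumes "multilinear sE sF n A" and "i < n" and "x i = 0"
  shows "A x = 0"
proof -
  have "A (x(i := 0 + 0)) = A (x(i := 0)) + A (x(i := 0))"
    by (rule multilinear_slot_add[OF assms(1,2)])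
  moreover have "x(i := 0) = x" using assms(3) by auto
  ultimately show ?thesis by simp
qed

text \<open>
  The base values \<open>x\<close> must be arbitrary in the induction: splitting a new slot \<open>s\<close> yields one copy
  of the expansion in which slot \<open>s\<close> carries \<open>x s\<close>, and one in which it carries \<open>y s\<close>. These are
  the subsets without and with \<open>s\<close>.
\<close>

lemma multilinear_expand_sum:
  assumes A: "multilinear sE sF n A" and "finite S" and "S \<subseteq> {..<n}"
  shows "A (\<lambda>i. if i \<in> S then x i + y i else x i)
    = (\<Sum>T\<in>Pow S. A (\<lambda>i. if i \<in> T then y i else x i))"
  using assms(2,3)
proof (induction S arbitrary: x rule: finite_induct)
  case empty
  then show ?case by simp
next
  case (insert s S)
  let ?z = "\<lambda>i. if i \<in> S then x i + y i else x i"
  let ?x = "x(s := y s)"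
  have S: "S \<subseteq> {..<n}" and s: "s < n" using insert.prems by auto
  have "A (\<lambda>i. if i \<in> insert s S then x i + y i else x i) = A (?z(s := x s + y s))"
    by (rule arg_cong[of _ _ A]) auto
  also have "\<dots> = A (?z(s := x s)) + A (?z(s := y s))"
    by (rule multilinear_slot_add[OF A s])
  also have "?z(s := x s) = ?z" using insert.hyps by auto
  also have "?z(s := y s) = (\<lambda>i. if i \<in> S then ?x i + y i else ?x i)"
    using insert.hyps by auto
  also have "A \<dots> = (\<Sum>T\<in>Pow S. A (\<lambda>i. if i \<in> T then y i else ?x i))"
    by (rule insert.IH[OF S])
  also have "\<dots> = (\<Sum>T\<in>Pow S. A (\<lambda>i. if i \<in> insert s T then y i else x i))"
    by (intro sum.cong refl arg_cong[of _ _ A]) auto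
  also have "\<dots> = (\<Sum>T\<in>insert s ` Pow S. A (\<lambda>i. if i \<in> T then y i else x i))"
  proof (subst sum.reindex)
    show "inj_on (insert s) (Pow S)"
      using insert.hyps by (auto simp: inj_on_def)
  qed simp
  also have "A ?z = (\<Sum>T\<in>Pow S. A (\<lambda>i. if i \<in> T then y i else x i))"
    by (rule insert.IH[OF S])
  finally show ?case
    unfolding Pow_insert using insert.hyps
    by (subst sum.union_disjoint) auto
qed

lemma multilinear_scale_on:
  assumes A: "multilinear sE sF n A" and F: "vector_space sF"
    and "finite S" and "S \<subseteq> {..<n}"
  shows "A (\<lambda>i. if i \<in> S then sE c (x i) else x i) = sF (c ^ card S) (A x)"
proof -
  interpret F: vector_space sF by (rule F)
  show ?thesis
    using assms(3,4)
  proof (induction S rule: finite_induct)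
    case empty
    then show ?case by simp
  next
    case (insert s S)
    let ?z = "\<lambda>i. if i \<in> S then sE c (x i) else x i"
    have s: "s < n" using insert.prems by auto
    have "A (\<lambda>i. if i \<in> insert s S then sE c (x i) else x i) = A (?z(s := sE c (x s)))"
      by (rule arg_cong[of _ _ A]) auto
    also have "\<dots> = sF c (A (?z(s := x s)))"
      by (rule multilinear_slot_scale[OF A s])
    also have "?z(s := x s) = ?z" using insert.hyps by auto
    also have "A ?z = sF (c ^ card S) (A x)"
      using insert.IH insert.prems by auto
    finally show ?case
      using insert.hyps by simp
  qed
qed

text \<open>
  Permuting the arguments keeps the map linear in each slot (slot \<open>i\<close> becomes slot \<open>inv \<pi> i\<close>) and
  does not change its values on the diagonal. Averaging makes it symmetric because composition with
  a fixed permutation only reorders the sum.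
\<close>

lemma multilinear_symmetrize:
  fixes A :: "(nat \<Rightarrow> 'e::ab_group_add) \<Rightarrow> 'f::ab_group_add"
    and sF :: "'k::field_char_0 \<Rightarrow> 'f \<Rightarrow> 'f"
  assumes E: "vector_space sE" and F: "vector_space sF" and A: "multilinear sE sF n A"
  defines "B \<equiv> (\<lambda>x. sF (1 / fact n) (\<Sum>\<pi>\<in>{\<pi>. \<pi> permutes {..<n}}. A (x \<circ> \<pi>)))"
  shows "multilinear sE sF n B" and "symmetric n B" and "B (\<lambda>_. x) = A (\<lambda>_. x)"
proof -
  interpret E: vector_space sE by (rule E)
  interpret F: vector_space sF by (rule F)
  interpret EF: vector_space_pair sE sF ..
  show "multilinear sE sF n B"
    unfolding multilinear_def
  proof (intro conjI allI impI)
    fix x y :: "nat \<Rightarrow> 'e"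
    assume xy: "\<forall>i<n. x i = y i"
    have "A (x \<circ> \<pi>) = A (y \<circ> \<pi>)" if "\<pi> permutes {..<n}" for \<pi>
    proof (rule multilinear_cong[OF A])
      fix i assume "i < n"
      then have "\<pi> i < n" using permutes_in_image[OF that] by (metis lessThan_iff)
      then show "(x \<circ> \<pi>) i = (y \<circ> \<pi>) i" using xy by simp
    qed
    then show "B x = B y" unfolding B_def by simp
  next
    fix x :: "nat \<Rightarrow> 'e" and i
    assume i: "i < n"
    have "Vector_Spaces.linear sE sF (\<lambda>t. A (x(i := t) \<circ> \<pi>))" if \<pi>: "\<pi> permutes {..<n}" for \<pi>
    proof -
      have "x(i := t) \<circ> \<pi> = (x \<circ> \<pi>)(inv \<pi> i := t)" for t
        using permutes_inverses[OF \<pi>] by (auto simp: fun_eq_iff)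
      moreover have "inv \<pi> i < n"
        using permutes_in_image[OF permutes_inv[OF \<pi>], of i] i by simp
      ultimately show ?thesis
        using multilinear_slot_linear[OF A, of "inv \<pi> i" "x \<circ> \<pi>"] by simp
    qed
    then show "Vector_Spaces.linear sE sF (\<lambda>t. B (x(i := t)))"
      unfolding B_def
      by (intro EF.linear_compose_scale_right EF.linear_compose_sum) auto
  qed
  show "symmetric n B"
    unfolding symmetric_def
  proof (intro allI impI)
    fix \<sigma> and x :: "nat \<Rightarrow> 'e"
    assume "\<sigma> permutes {..<n}"
    from setum_permutations_compose_left[OF this, of "\<lambda>\<pi>. A (x \<circ> \<pi>)"]
    show "B (x \<circ> \<sigma>) = B x" unfolding B_def by (simp only: comp_assoc)
  qed
  have "B (\<lambda>_. x) = sF (1 / fact n) (\<Sum>\<pi>\<in>{\<pi>. \<pi> permutes {..<n}}. A (\<lambda>_. x))"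
    unfolding B_def by (simp add: comp_def)
  also have "\<dots> = sF (1 / fact n) (sF (of_nat (fact n)) (A (\<lambda>_. x)))"
    by (simp add: F.sum_constant_scale card_permutations[of "{..<n}" n])
  finally show "B (\<lambda>_. x) = A (\<lambda>_. x)" by simp
qed

text \<open>
  This brings the slots in \<open>S\<close> to the end of the tuple, which is where \<open>hat_d\<close> places its variable
  argument.
\<close>

lemma permutation_onto_final_segment:
  assumes "S \<subseteq> {..<n}"
  obtains \<pi> where "\<pi> permutes {..<n}" and "\<And>i. i < n \<Longrightarrow> \<pi> i \<in> S \<longleftrightarrow> n - card S \<le> i"
proof -
  let ?k = "card S"
  have fS: "finite S" and k: "?k \<le> n"
    using assms finite_subset card_mono[of "{..<n}" S] by auto
  obtain f where f: "bij_betw f {n - ?k..<n} S"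
    using finite_same_card_bij[of "{n - ?k..<n}" S] fS k by auto
  obtain g where g: "bij_betw g {..<n - ?k} ({..<n} - S)"
    using finite_same_card_bij[of "{..<n - ?k}" "{..<n} - S"] fS assms
    by (auto simp: card_Diff_subset)
  define \<pi> where "\<pi> i = (if i < n - ?k then g i else if i < n then f i else i)" for i
  have 1: "bij_betw \<pi> {..<n - ?k} ({..<n} - S)"
    using g by (subst bij_betw_cong[of _ _ g]) (auto simp: \<pi>_def)
  have 2: "bij_betw \<pi> {n - ?k..<n} S"
    using f by (subst bij_betw_cong[of _ _ f]) (auto simp: \<pi>_def)
  have "bij_betw \<pi> ({..<n - ?k} \<union> {n - ?k..<n}) (({..<n} - S) \<union> S)"
    by (rule bij_betw_combine[OF 1 2]) auto
  moreover have "{..<n - ?k} \<union> {n - ?k..<n} = {..<n}" "({..<n} - S) \<union> S = {..<n}"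
    using assms by auto
  ultimately have "\<pi> permutes {..<n}"
    by (intro bij_imp_permutes) (auto simp: \<pi>_def)
  moreover have "\<pi> i \<in> S \<longleftrightarrow> n - ?k \<le> i" if "i < n" for i
    using bij_betwE[OF 1] bij_betwE[OF 2] that
    by (cases "i < n - ?k") auto
  ultimately show thesis using that by blast
qed

lemma symmetric_two_valued:
  assumes A: "multilinear sE sF n A" and "symmetric n A" and "S \<subseteq> {..<n}"
  shows "A (\<lambda>i. if i \<in> S then x else a) = A (\<lambda>i. if i < n - card S then a else x)"
proof -
  obtain \<pi> where \<pi>: "\<pi> permutes {..<n}" "\<And>i. i < n \<Longrightarrow> \<pi> i \<in> S \<longleftrightarrow> n - card S \<le> i"
    using permutation_onto_final_segment[OF assms(3)] by blast
  have "A (\<lambda>i. if i \<in> S then x else a) = A ((\<lambda>i. if i \<in> S then x else a) \<circ> \<pi>)"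
    using assms(2) \<pi>(1) unfolding symmetric_def by simp
  also have "\<dots> = A (\<lambda>i. if i < n - card S then a else x)"
    by (rule multilinear_cong[OF A]) (auto simp: \<pi>(2))
  finally show ?thesis .
qed

text \<open>
  In the expansion over subsets of slots, symmetry makes a term depend on the size of the subset
  only, so that grouping by size produces the binomial coefficients.
\<close>

lemma symmetric_multilinear_binomial:
  fixes A :: "(nat \<Rightarrow> 'e::ab_group_add) \<Rightarrow> 'f::real_vector"
  assumes A: "multilinear sE sF n A" and sym: "symmetric n A"
  shows "A (\<lambda>_. a + x)
    = (\<Sum>k\<le>n. of_nat (n choose k) *\<^sub>R A (\<lambda>i. if i < n - k then a else x))"
proof -
  let ?D = "\<lambda>k. A (\<lambda>i. if i < n - k then a else x)"
  have card: "card T \<le> n" if "T \<subseteq> {..<n}" for T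
    using card_mono[OF _ that] by simp
  have "A (\<lambda>_. a + x) = A (\<lambda>i. if i \<in> {..<n} then a + x else a)"
    by (rule multilinear_cong[OF A]) simp
  also have "\<dots> = (\<Sum>T\<in>Pow {..<n}. A (\<lambda>i. if i \<in> T then x else a))"
    by (rule multilinear_expand_sum[OF A]) auto
  also have "\<dots> = (\<Sum>T\<in>Pow {..<n}. ?D (card T))"
    by (rule sum.cong[OF refl], rule symmetric_two_valued[OF A sym]) simp
  also have "\<dots> = (\<Sum>k\<le>n. \<Sum>T\<in>{T \<in> Pow {..<n}. card T = k}. ?D (card T))"
    by (rule sum.group[symmetric]) (use card in auto)
  also have "\<dots> = (\<Sum>k\<le>n. of_nat (n choose k) *\<^sub>R ?D k)"
  proof (rule sum.cong[OF refl])
    fix k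
    have "(\<Sum>T\<in>{T \<in> Pow {..<n}. card T = k}. ?D (card T))
      = (\<Sum>T\<in>{T. T \<subseteq> {..<n} \<and> card T = k}. ?D k)"
      by (rule sum.cong) auto
    then show "(\<Sum>T\<in>{T \<in> Pow {..<n}. card T = k}. ?D (card T)) = of_nat (n choose k) *\<^sub>R ?D k"
      by (simp add: n_subsets scaleR_conv_of_real sum_constant_scaleR)
  qed
  finally show ?thesis .
qed

section \<open>Taylor expansion of a homogeneous polynomial\<close>

lemma (in banach_space_over) scale_nat_fraction:
  "scale (of_nat m / of_nat k) x = (real m / real k) *\<^sub>R x"
  using scale_of_real[of "real m / real k" x] by simp

text \<open>This justifies the choice operator in the definition of \<open>polar\<close>.\<close>

lemma polar:
  assumes "banach_space_over sE" and "banach_space_over sF"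
    and "P \<in> homogeneous_polynomials sE sF n"
  shows "multilinear sE sF n (polar sE sF n P)" and "symmetric n (polar sE sF n P)"
    and "P x = polar sE sF n P (\<lambda>_. x)"
proof -
  obtain A where A: "multilinear sE sF n A" "\<And>x. P x = A (\<lambda>_. x)"
    using assms(3) unfolding homogeneous_polynomials_def by auto
  have E: "vector_space sE" and F: "vector_space sF"
    using assms unfolding banach_space_over_def by auto
  note sym = multilinear_symmetrize[OF E F A(1)]
  have "\<exists>B. multilinear sE sF n B \<and> symmetric n B \<and> (\<forall>x. P x = B (\<lambda>_. x))"
    unfolding A(2)
    by (intro exI conjI allI, rule sym(1), rule sym(2), rule sym(3)[symmetric])
  from someI_ex[OF this]
  have "multilinear sE sF n (polar sE sF n P) \<and> symmetric n (polar sE sF n P)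
    \<and> (\<forall>x. P x = polar sE sF n P (\<lambda>_. x))"
    unfolding polar_def .
  then show "multilinear sE sF n (polar sE sF n P)" "symmetric n (polar sE sF n P)"
    "P x = polar sE sF n P (\<lambda>_. x)"
    by blast+
qed

lemma hat_d_eq_scaleR:
  assumes "banach_space_over sF"
  shows "hat_d sE sF n k P a x
    = (fact n / fact (n - k)) *\<^sub>R polar sE sF n P (\<lambda>i. if i < n - k then a else x)"
  unfolding hat_d_def
  using banach_space_over.scale_nat_fraction[OF assms, of "fact n" "fact (n - k)"] by simp

lemma hat_d_zero:
  assumes "banach_space_over sE" and F: "banach_space_over sF"
    and "P \<in> homogeneous_polynomials sE sF n" and "k \<in> {1..n}"
  shows "hat_d sE sF n k P a 0 = 0"
proof -
  have "polar sE sF n P (\<lambda>i. if i < n - k then a else 0) = 0"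
    by (rule multilinear_zero_slot[OF polar(1)[OF assms(1-3)], of "n - 1"]) (use assms(4) in auto)
  then show ?thesis by (simp add: hat_d_eq_scaleR[OF F])
qed

lemma hat_d_homogeneous:
  assumes E: "banach_space_over sE" and F: "banach_space_over sF"
    and P: "P \<in> homogeneous_polynomials sE sF n" and k: "k \<in> {1..n}"
  shows "hat_d sE sF n k P a (r *\<^sub>R x) = r ^ k *\<^sub>R hat_d sE sF n k P a x"
proof -
  let ?A = "polar sE sF n P" and ?y = "\<lambda>i. if i < n - k then a else x"
  note A = polar(1)[OF assms(1-3)]
  have "?A (\<lambda>i. if i < n - k then a else r *\<^sub>R x)
    = ?A (\<lambda>i. if i \<in> {n - k..<n} then sE (of_real r) (?y i) else ?y i)"
    by (rule multilinear_cong[OF A]) (auto simp: banach_space_over.scale_of_real[OF E])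
  also have "\<dots> = sF (of_real r ^ card {n - k..<n}) (?A ?y)"
    using F by (intro multilinear_scale_on[OF A]) (auto simp: banach_space_over_def)
  also have "\<dots> = r ^ k *\<^sub>R ?A ?y"
    using k banach_space_over.scale_of_real[OF F, of "r ^ k"] by simp
  finally show ?thesis by (simp add: hat_d_eq_scaleR[OF F])
qed

text \<open>
  The coefficient \<open>n! / (n - k)!\<close> in \<open>hat_d\<close>, divided by \<open>k!\<close>, is the binomial coefficient of the
  expansion of \<open>P (a + x)\<close>; the term of degree \<open>0\<close> is \<open>P a\<close>.
\<close>

lemma homogeneous_polynomial_taylor:
  assumes "banach_space_over sE" and F: "banach_space_over sF"
    and "P \<in> homogeneous_polynomials sE sF n"
  shows "P (a + x) - P a = (\<Sum>k\<in>{1..n}. (1 / fact k) *\<^sub>R hat_d sE sF n k P a x)"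
proof -
  note A = polar[OF assms]
  let ?D = "\<lambda>k. polar sE sF n P (\<lambda>i. if i < n - k then a else x)"
  have "P (a + x) = (\<Sum>k\<le>n. of_nat (n choose k) *\<^sub>R ?D k)"
    unfolding A(3)[of "a + x"] by (rule symmetric_multilinear_binomial[OF A(1,2)])
  also have "{..n} = insert 0 {1..n}" by auto
  also have "(\<Sum>k\<in>\<dots>. of_nat (n choose k) *\<^sub>R ?D k)
    = ?D 0 + (\<Sum>k\<in>{1..n}. of_nat (n choose k) *\<^sub>R ?D k)"
    by simp
  also have "?D 0 = P a"
    unfolding A(3)[of a] by (rule multilinear_cong[OF A(1)]) simp
  also have "(\<Sum>k\<in>{1..n}. of_nat (n choose k) *\<^sub>R ?D k)
    = (\<Sum>k\<in>{1..n}. (1 / fact k) *\<^sub>R hat_d sE sF n k P a x)"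
    by (rule sum.cong) (auto simp: hat_d_eq_scaleR[OF F] binomial_fact)
  finally show ?thesis by simp
qed

section \<open>Sequence spaces\<close>

lemma lp_seqs_add:
  assumes "x \<in> lp_seqs p" and "y \<in> lp_seqs p" and "p \<ge> 0"
  shows "(\<lambda>j. x j + y j) \<in> lp_seqs p"
proof -
  have bound: "norm (x j + y j) powr p \<le> 2 powr p * (norm (x j) powr p + norm (y j) powr p)" for j
  proof -
    let ?m = "max (norm (x j)) (norm (y j))"
    have "norm (x j + y j) powr p \<le> (2 * ?m) powr p"
      using norm_triangle_ineq[of "x j" "y j"] assms(3) by (intro powr_mono2) auto
    also have "\<dots> = 2 powr p * ?m powr p" by (intro powr_mult)
    also have "?m powr p \<le> norm (x j) powr p + norm (y j) powr p"
      by (auto simp: max_def)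
    finally show ?thesis by simp
  qed
  have "summable (\<lambda>j. 2 powr p * (norm (x j) powr p + norm (y j) powr p))"
    using assms unfolding lp_seqs_def by (intro summable_mult summable_add) auto
  then show ?thesis
    unfolding lp_seqs_def mem_Collect_eq
    by (rule summable_comparison_test') (use bound in auto)
qed

lemma lp_seqs_scaleR:
  assumes "x \<in> lp_seqs p"
  shows "(\<lambda>j. c *\<^sub>R x j) \<in> lp_seqs p"
  using assms unfolding lp_seqs_def by (simp add: powr_mult summable_mult)

lemma lp_seqs_diff:
  assumes "x \<in> lp_seqs p" and "y \<in> lp_seqs p" and "p \<ge> 0"
  shows "(\<lambda>j. x j - y j) \<in> lp_seqs p"
  using lp_seqs_add[OF assms(1) lp_seqs_scaleR[OF assms(2), of "-1"] assms(3)] by simp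

lemma lp_seqs_sum:
  assumes "\<And>k. k \<in> K \<Longrightarrow> x k \<in> lp_seqs p" and "p \<ge> 0"
  shows "(\<lambda>j. \<Sum>k\<in>K. x k j) \<in> lp_seqs p"
  using assms(1)
proof (induction K rule: infinite_finite_induct)
  case (insert k K)
  then show ?case using lp_seqs_add[of "x k" p "\<lambda>j. \<Sum>k\<in>K. x k j"] assms(2) by simp
qed (simp_all add: lp_seqs_def)

lemma norm_dual_scaleR:
  assumes "banach_space_over sE" and "\<phi> \<in> dual_space sE"
  shows "norm (\<phi> (r *\<^sub>R x)) = \<bar>r\<bar> * norm (\<phi> x)"
proof -
  have "\<phi> (r *\<^sub>R x) = of_real r * \<phi> x"
    using assms(2) unfolding banach_space_over.scale_of_real[OF assms(1), symmetric]
    by (simp add: dual_space_def Vector_Spaces.linear_iff)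
  then show ?thesis by (simp add: norm_mult)
qed

text \<open>
  Weak \<open>q\<close>-summability of \<open>x\<close> matters here: it makes the inner series converge, and only then may
  the factor \<open>\<bar>r\<bar> powr q\<close> be taken out of it.
\<close>

lemma weak_norm_scaleR_le:
  assumes E: "banach_space_over sE" and x: "x \<in> weak_lq_seqs sE q" and q: "q > 0"
  shows "weak_norm sE q (\<lambda>j. r *\<^sub>R x j) \<le> ennreal \<bar>r\<bar> * weak_norm sE q x"
  unfolding weak_norm_def
proof (rule SUP_least)
  fix \<phi> assume \<phi>: "\<phi> \<in> {\<phi> \<in> dual_space sE. onorm \<phi> \<le> 1}"
  let ?N = "\<lambda>\<phi>. (\<Sum>j. norm (\<phi> (x j)) powr q) powr (1 / q)"
  have sm: "summable (\<lambda>j. norm (\<phi> (x j)) powr q)"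
    using x \<phi> unfolding weak_lq_seqs_def lp_seqs_def by auto
  have "(\<Sum>j. norm (\<phi> (r *\<^sub>R x j)) powr q) = \<bar>r\<bar> powr q * (\<Sum>j. norm (\<phi> (x j)) powr q)"
    using \<phi> sm by (simp add: norm_dual_scaleR[OF E] powr_mult suminf_mult)
  then have "(\<Sum>j. norm (\<phi> (r *\<^sub>R x j)) powr q) powr (1 / q) = \<bar>r\<bar> * ?N \<phi>"
    using q sm by (simp add: powr_mult powr_powr suminf_nonneg)
  then have "ennreal ((\<Sum>j. norm (\<phi> (r *\<^sub>R x j)) powr q) powr (1 / q)) = ennreal \<bar>r\<bar> * ennreal (?N \<phi>)"
    by (simp add: ennreal_mult)
  also have "\<dots> \<le> ennreal \<bar>r\<bar> * (SUP \<phi>\<in>{\<phi> \<in> dual_space sE. onorm \<phi> \<le> 1}. ennreal (?N \<phi>))"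
    using \<phi> by (intro mult_left_mono SUP_upper) auto
  finally show "ennreal ((\<Sum>j. norm (\<phi> (r *\<^sub>R x j)) powr q) powr (1 / q))
    \<le> ennreal \<bar>r\<bar> * (SUP \<phi>\<in>{\<phi> \<in> dual_space sE. onorm \<phi> \<le> 1}. ennreal (?N \<phi>))" .
qed

lemma unconditional_lq_seqs_scaleR:
  assumes E: "banach_space_over sE" and x: "x \<in> unconditional_lq_seqs sE q" and q: "q > 0"
  shows "(\<lambda>j. r *\<^sub>R x j) \<in> unconditional_lq_seqs sE q"
proof -
  have w: "x \<in> weak_lq_seqs sE q" and lim: "(\<lambda>k. weak_norm sE q (\<lambda>j. x (k + j))) \<longlonglongrightarrow> 0"
    using x unfolding unconditional_lq_seqs_def by auto
  have shift: "(\<lambda>j. x (k + j)) \<in> weak_lq_seqs sE q" for k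
    using w unfolding weak_lq_seqs_def lp_seqs_def
    by (auto simp: add.commute intro: summable_ignore_initial_segment)
  have "(\<lambda>k. ennreal \<bar>r\<bar> * weak_norm sE q (\<lambda>j. x (k + j))) \<longlonglongrightarrow> ennreal \<bar>r\<bar> * 0"
    by (rule ennreal_tendsto_cmult[OF _ lim]) simp
  then have up: "(\<lambda>k. ennreal \<bar>r\<bar> * weak_norm sE q (\<lambda>j. x (k + j))) \<longlonglongrightarrow> 0"
    by simp
  have "(\<lambda>k. weak_norm sE q (\<lambda>j. r *\<^sub>R x (k + j))) \<longlonglongrightarrow> 0"
    by (rule tendsto_sandwich[OF _ _ tendsto_const up])
      (use weak_norm_scaleR_le[OF E shift q] in auto)
  moreover have "(\<lambda>j. r *\<^sub>R x j) \<in> weak_lq_seqs sE q"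
    using w unfolding weak_lq_seqs_def lp_seqs_def
    by (auto simp: norm_dual_scaleR[OF E] powr_mult intro!: summable_mult)
  ultimately show ?thesis unfolding unconditional_lq_seqs_def by simp
qed

section \<open>Separating homogeneous components\<close>

text \<open>
  Applying the assumption on the sum of the \<open>Q k\<close> both to \<open>2 x\<close>
  and to \<open>x\<close>, and subtracting \<open>2 ^ m\<close> times the second from the first, removes the degree \<open>m\<close> and
  leaves the homogeneous components \<open>(2 ^ k - 2 ^ m) Q k\<close>, to which the induction hypothesis
  applies. The component of degree \<open>m\<close> is then the difference of the full sum and the others.
\<close>

lemma homogeneous_components_in_lp_seqs:
  fixes Q :: "nat \<Rightarrow> 'e::real_vector \<Rightarrow> 'f::real_normed_vector"
  assumes "finite K" and "p \<ge> 0"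
    and X: "\<And>x. x \<in> X \<Longrightarrow> (\<lambda>j. 2 *\<^sub>R x j) \<in> X"
    and "\<And>k x. k \<in> K \<Longrightarrow> Q k (2 *\<^sub>R x) = 2 ^ k *\<^sub>R Q k x"
    and "\<And>x. x \<in> X \<Longrightarrow> (\<lambda>j. \<Sum>k\<in>K. Q k (x j)) \<in> lp_seqs p"
    and "k \<in> K" and "x \<in> X"
  shows "(\<lambda>j. Q k (x j)) \<in> lp_seqs p"
  using assms(1,4-)
proof (induction K arbitrary: Q k x rule: finite_induct)
  case empty
  then show ?case by simp
next
  case (insert m K)
  define Q' where "Q' k x = (2 ^ k - 2 ^ m :: real) *\<^sub>R Q k x" for k x
  have hom: "Q k (2 *\<^sub>R x) = 2 ^ k *\<^sub>R Q k x" if "k \<in> insert m K" for k x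
    using insert.prems(1) that .
  have total: "(\<lambda>j. \<Sum>k\<in>insert m K. Q k (x j)) \<in> lp_seqs p" if "x \<in> X" for x
    using insert.prems(2) that .
  have lower: "(\<lambda>j. Q k (x j)) \<in> lp_seqs p" if k: "k \<in> K" and x: "x \<in> X" for k x
  proof -
    have "(\<lambda>j. Q' k (x j)) \<in> lp_seqs p"
    proof (rule insert.IH[OF _ _ k x])
      show "Q' l (2 *\<^sub>R y) = 2 ^ l *\<^sub>R Q' l y" if "l \<in> K" for l y
        using hom[of l y] that by (simp add: Q'_def mult.commute)
      show "(\<lambda>j. \<Sum>l\<in>K. Q' l (y j)) \<in> lp_seqs p" if y: "y \<in> X" for y
      proof -
        have "(\<Sum>l\<in>insert m K. Q l (2 *\<^sub>R y j)) - 2 ^ m *\<^sub>R (\<Sum>l\<in>insert m K. Q l (y j))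
          = (\<Sum>l\<in>insert m K. Q' l (y j))" for j
          by (simp add: hom Q'_def scaleR_sum_right scaleR_diff_left del: sum.insert
              flip: sum_subtractf)
        also have "(\<Sum>l\<in>insert m K. Q' l (y j)) = (\<Sum>l\<in>K. Q' l (y j))" for j
          using insert.hyps by (simp add: Q'_def)
        finally have "(\<lambda>j. \<Sum>l\<in>K. Q' l (y j))
          = (\<lambda>j. (\<Sum>l\<in>insert m K. Q l (2 *\<^sub>R y j)) - 2 ^ m *\<^sub>R (\<Sum>l\<in>insert m K. Q l (y j)))"
          by simp
        then show ?thesis
          using lp_seqs_diff[OF total[OF X[OF y]] lp_seqs_scaleR[OF total[OF y]] assms(2)]
          by simp
      qed
    qed
    from lp_seqs_scaleR[OF this, of "1 / (2 ^ k - 2 ^ m)"] show ?thesis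
      using insert.hyps k unfolding Q'_def by (cases "k = m") auto
  qed
  show ?case
  proof (cases "k = m")
    case True
    have "Q m (x j) = (\<Sum>l\<in>insert m K. Q l (x j)) - (\<Sum>l\<in>K. Q l (x j))" for j
      using insert.hyps by simp
    moreover have "(\<lambda>j. \<Sum>l\<in>K. Q l (x j)) \<in> lp_seqs p"
      using lower insert.prems(4) assms(2) by (intro lp_seqs_sum) auto
    ultimately show ?thesis
      using lp_seqs_diff[OF total[OF insert.prems(4)] _ assms(2)] True by simp
  next
    case False
    then show ?thesis using lower insert.prems(3,4) by simp
  qed
qed

theorem theorem3p8:
  fixes scaleE :: "'k::real_normed_field \<Rightarrow> 'e::banach \<Rightarrow> 'e"
    and scaleF :: "'k \<Rightarrow> 'f::banach \<Rightarrow> 'f"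
    and n :: nat and p q :: real and P :: "'e \<Rightarrow> 'f" and a :: 'e
  assumes "banach_space_over scaleE" and "banach_space_over scaleF"
    and "n \<ge> 1" and "1 \<le> q" and "q \<le> p"
    and "P \<in> homogeneous_polynomials scaleE scaleF n"
  shows "a \<in> summing_set scaleE p q P \<longleftrightarrow>
    (\<forall>k\<in>{1..n}. 0 \<in> summing_set scaleE p q (hat_d scaleE scaleF n k P a))"
proof -
  note E = assms(1) and F = assms(2) and P = assms(6)
  let ?D = "\<lambda>k. hat_d scaleE scaleF n k P a" and ?U = "unconditional_lq_seqs scaleE q"
  have p: "p \<ge> 0" using assms(4,5) by simp
  have at_a: "a \<in> summing_set scaleE p q P \<longleftrightarrow>
    (\<forall>x\<in>?U. (\<lambda>j. \<Sum>k\<in>{1..n}. (1 / fact k) *\<^sub>R ?D k (x j)) \<in> lp_seqs p)"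
    by (simp add: summing_set_def summing_at_def homogeneous_polynomial_taylor[OF E F P])
  have at_0: "0 \<in> summing_set scaleE p q (?D k) \<longleftrightarrow> (\<forall>x\<in>?U. (\<lambda>j. ?D k (x j)) \<in> lp_seqs p)"
    if "k \<in> {1..n}" for k
    by (simp add: summing_set_def summing_at_def hat_d_zero[OF E F P that])
  show ?thesis
  proof
    assume "\<forall>k\<in>{1..n}. 0 \<in> summing_set scaleE p q (?D k)"
    then show "a \<in> summing_set scaleE p q P"
      unfolding at_a using at_0 p by (intro ballI lp_seqs_sum lp_seqs_scaleR) auto
  next
    assume "a \<in> summing_set scaleE p q P"
    then have total: "(\<lambda>j. \<Sum>k\<in>{1..n}. (1 / fact k) *\<^sub>R ?D k (x j)) \<in> lp_seqs p" if "x \<in> ?U" for x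
      using that unfolding at_a by blast
    show "\<forall>k\<in>{1..n}. 0 \<in> summing_set scaleE p q (?D k)"
    proof
      fix k assume k: "k \<in> {1..n}"
      have "(\<lambda>j. ?D k (x j)) \<in> lp_seqs p" if x: "x \<in> ?U" for x
      proof -
        have "(\<lambda>j. (1 / fact k) *\<^sub>R ?D k (x j)) \<in> lp_seqs p"
        proof (rule homogeneous_components_in_lp_seqs[where K = "{1..n}" and X = ?U
              and Q = "\<lambda>k x. (1 / fact k) *\<^sub>R ?D k x", OF _ p _ _ total k x])
          show "(\<lambda>j. 2 *\<^sub>R y j) \<in> ?U" if "y \<in> ?U" for y
            using unconditional_lq_seqs_scaleR[OF E that] assms(4) by simp
          show "(1 / fact l) *\<^sub>R ?D l (2 *\<^sub>R y) = 2 ^ l *\<^sub>R (1 / fact l) *\<^sub>R ?D l y"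
            if "l \<in> {1..n}" for l y
            by (simp add: hat_d_homogeneous[OF E F P that])
        qed simp
        from lp_seqs_scaleR[OF this, of "fact k"] show ?thesis by simp
      qed
      then show "0 \<in> summing_set scaleE p q (?D k)" using at_0[OF k] by blast
    qed
  qed
qed

end
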